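(* Let $n\ge 2$ and $1\le w\le n-1$ be integers. If there exists a cyclic optimal constant-weight Gray code of weight $w$ for $(1,2,n)$-LRM, then for every color $a\in\{0,1,\dots,n-1\}$ there are exactly $\binom{n}{w}/n$ strings $v\in S(n,w)$ with $\chi(v)=a$.
   Context: Write a binary string of length $n$ as $v=v_0v_1\cdots v_{n-1}$ with indices taken modulo $n$. Let $S(n,w)$ be the set of binary strings of length $n$ with exactly $w$ ones (weight $w$). The color of $v\in S(n,w)$ is $\chi(v)=\left(\sum_{j=0}^{n-1} j\,v_j\right)\bmod n\in\{0,\dots,n-1\}$. For $0\le j\le n-1$, the string $v'=\tau_j(v)$ is given by $v'_j=0$, $v'_{j+1}=1$ (index mod $n$), and $v'_k=v_k$ for all other $k$. A constant-weight Gray code of weight $w$ and size $N$ for $(1,2,n)$-LRM ("local rank modulation") is a sequence $G=g_0,\dots,g_{N-1}$ of distinct strings in $S(n,w)$ such that for every $0\le i\le N-2$ there is a $j$ with $g_{i+1}=\tau_j(g_i)$. It is cyclic if in addition $g_0=\tau_j(g_{N-1})$ for some $j$. It is optimal if $N=\binom{n}{w}$. *)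

theory Defs
  imports Complex_Main
begin

definition weight :: "bool list \<Rightarrow> nat" where
  "weight v = card {j. j < length v \<and> v ! j}"

definition strings :: "nat \<Rightarrow> nat \<Rightarrow> bool list set" where
  "strings n w = {v. length v = n \<and> weight v = w}"

definition color :: "nat \<Rightarrow> bool list \<Rightarrow> nat" where
  "color n v = (\<Sum>j<n. j * of_bool (v ! j)) mod n"

text \<open>
  No condition on the old entries at positions \<open>j\<close> and \<open>j + 1\<close> is imposed. When \<open>n \<ge> 2\<close> and
  \<open>v\<close> and \<open>tau n j v\<close> are distinct strings of equal weight, they are necessarily 1 and 0.
\<close>

definition tau :: "nat \<Rightarrow> nat \<Rightarrow> bool list \<Rightarrow> bool list" where
  "tau n j v = v[j := False, (j + 1) mod n := True]"

definition gray_code :: "nat \<Rightarrow> nat \<Rightarrow> nat \<Rightarrow> bool list list \<Rightarrow> bool" where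
  "gray_code n w N G \<longleftrightarrow>
     length G = N \<and> distinct G \<and> set G \<subseteq> strings n w \<and>
     (\<forall>i. i + 1 < N \<longrightarrow> (\<exists>j<n. G ! (i + 1) = tau n j (G ! i)))"

definition cyclic_gray_code :: "nat \<Rightarrow> nat \<Rightarrow> nat \<Rightarrow> bool list list \<Rightarrow> bool" where
  "cyclic_gray_code n w N G \<longleftrightarrow>
     gray_code n w N G \<and> N > 0 \<and> (\<exists>j<n. G ! 0 = tau n j (G ! (N - 1)))"

definition cyclic_optimal_gray_code :: "nat \<Rightarrow> nat \<Rightarrow> bool list list \<Rightarrow> bool" where
  "cyclic_optimal_gray_code n w G \<longleftrightarrow> cyclic_gray_code n w (n choose w) G"

end

theory Submission
  imports Defs "HOL-Number_Theory.Cong"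
begin

text \<open>
  A step between distinct strings of equal weight moves a one from position \<open>j\<close> to
  \<open>j + 1\<close> modulo \<open>n\<close>, so it raises the color by exactly 1 modulo \<open>n\<close>. Along the code the colors
  therefore run cyclically through the residues, and since the code closes up, its length is a
  multiple of \<open>n\<close>; each residue is met equally often. Optimality says that the code visits every
  string.
\<close>

lemma weight_eq_sum: "weight v = (\<Sum>i<length v. of_bool (v ! i))"
proof -
  have "{j. j < length v \<and> v ! j} = {..<length v} \<inter> {j. v ! j}" by auto
  then show ?thesis by (simp add: weight_def of_bool_def sum.If_cases)
qed

text \<open>A string of length \<open>n\<close> is determined by its support. The count later yields
  that \<open>strings n w\<close> is finite and that the code exhausts it.\<close>

lemma card_strings: "card (strings n w) = n choose w"
proof -
  have "bij_betw (\<lambda>v. {j. j < n \<and> v ! j}) (strings n w) {B. B \<subseteq> {..<n} \<and> card B = w}"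
  proof (rule bij_betw_byWitness[where f' = "\<lambda>B. map (\<lambda>j. j \<in> B) [0..<n]"])
    have "map (\<lambda>j. j \<in> B) [0..<n] \<in> strings n w" if B: "B \<subseteq> {..<n}" "card B = w" for B
    proof -
      have "{j. j < n \<and> map (\<lambda>j. j \<in> B) [0..<n] ! j} = B" using B by auto
      with B show ?thesis
        by (simp add: strings_def weight_def cong: conj_cong)
    qed
    then show "(\<lambda>B. map (\<lambda>j. j \<in> B) [0..<n]) ` {B. B \<subseteq> {..<n} \<and> card B = w} \<subseteq> strings n w"
      by blast
  qed (auto simp: strings_def weight_def intro: nth_equalityI)
  then have "card (strings n w) = card {B. B \<subseteq> {..<n} \<and> card B = w}"
    by (rule bij_betw_same_card)
  then show ?thesis by (simp add: n_subsets)
qed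

text \<open>Used twice: \<open>f = 1\<close> tracks the weight, \<open>f = int\<close> the color
  before reduction. For \<open>n\<close> at least 2 the positions \<open>j\<close> and
  \<open>k\<close> differ, so the two updates do not interfere. A correction term vanishes if its
  entry already has the new value.\<close>

lemma sum_tau:
  fixes f :: "nat \<Rightarrow> int"
  assumes len: "length v = n" and j: "j < n" and n: "n \<ge> 2"
  defines "k \<equiv> (j + 1) mod n"
  shows "(\<Sum>i<n. f i * of_bool (tau n j v ! i)) =
    (\<Sum>i<n. f i * of_bool (v ! i)) - f j * of_bool (v ! j) + f k * (1 - of_bool (v ! k))"
proof -
  have k: "k < n" "k \<noteq> j"
    using n j by (auto simp: k_def mod_Suc)
  have tau: "tau n j v = v[j := False, k := True]"
    by (simp add: tau_def k_def)
  have "(\<Sum>i<n. f i * of_bool (tau n j v ! i)) =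
      (\<Sum>i<n. f i * of_bool (v ! i) - (if i = j then f j * of_bool (v ! j) else 0)
        + (if i = k then f k * (1 - of_bool (v ! k)) else 0))"
    by (rule sum.cong) (use len k j in \<open>auto simp: tau nth_list_update\<close>)
  also have "\<dots> = (\<Sum>i<n. f i * of_bool (v ! i)) - f j * of_bool (v ! j)
      + f k * (1 - of_bool (v ! k))"
    using j k by (simp add: sum.distrib sum_subtractf)
  finally show ?thesis .
qed

lemma cong_color: "[int (color n v) = (\<Sum>j<n. int j * of_bool (v ! j))] (mod int n)"
  by (simp add: color_def cong_def zmod_int)

lemma color_tau:
  assumes v: "v \<in> strings n w" and tv: "tau n j v \<in> strings n w" and ne: "tau n j v \<noteq> v"
    and j: "j < n" and n: "n \<ge> 2"
  shows "color n (tau n j v) = (color n v + 1) mod n"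
proof -
  define k where "k = (j + 1) mod n"
  have len: "length v = n" using v by (simp add: strings_def)
  have k: "k < n" using n by (simp add: k_def)
  have "int (weight (tau n j v)) = int (weight v)"
    using v tv by (simp add: strings_def)
  moreover have "int (weight u) = (\<Sum>i<n. 1 * of_bool (u ! i))" if "length u = n" for u
    using that by (simp add: weight_eq_sum)
  moreover have "length (tau n j v) = n" using len by (simp add: tau_def)
  ultimately have "(\<Sum>i<n. 1 * of_bool (tau n j v ! i)) = (\<Sum>i<n. 1 * of_bool (v ! i) :: int)"
    using len by metis
  \<comment> \<open>With \<open>f = 1\<close>, equal weights force the two corrections to cancel, so
    exactly one of the entries at \<open>j\<close> and \<open>k\<close> is a one.\<close>
  with sum_tau[OF len j n, of "\<lambda>_. 1"]
  have eq: "v ! j \<longleftrightarrow> \<not> v ! k"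
    by (cases "v ! j"; cases "v ! k") (auto simp: k_def)
  \<comment> \<open>Otherwise the entries are already 0 and 1, and the step would fix
    \<open>v\<close>.\<close>
  have "v ! j"
  proof (rule ccontr)
    assume "\<not> v ! j"
    with eq have "v[j := False] = v" "v[k := True] = v"
      by (metis list_update_id)+
    then have "tau n j v = v" by (simp add: tau_def k_def)
    with ne show False by simp
  qed
  with eq sum_tau[OF len j n, of int]
  have s: "(\<Sum>i<n. int i * of_bool (tau n j v ! i))
      = (\<Sum>i<n. int i * of_bool (v ! i)) + (int k - int j)"
    by (simp add: k_def)
  \<comment> \<open>This absorbs the wrap-around: for \<open>j = n - 1\<close> the difference
    \<open>k - j\<close> is \<open>1 - n\<close>, still 1 modulo \<open>n\<close>.\<close>
  have "[int k = int j + 1] (mod int n)"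
    by (simp add: k_def cong_def zmod_int add.commute)
  then have "[int k - int j = int j + 1 - int j] (mod int n)"
    by (rule cong_diff) simp
  then have d: "[int k - int j = 1] (mod int n)" by simp
  have "[int (color n (tau n j v)) = int (color n v) + 1] (mod int n)"
    using cong_color[of n "tau n j v"] cong_add[OF cong_sym[OF cong_color[of n v]] d]
    unfolding s by (rule cong_trans)
  then have "[color n (tau n j v) = color n v + 1] (mod n)"
    by (metis cong_int_iff of_nat_1 of_nat_add)
  moreover have "color n (tau n j v) < n" using n by (simp add: color_def)
  ultimately show ?thesis by (simp add: cong_def)
qed

text \<open>The numbers \<open>c + i\<close> fill \<open>m\<close> complete periods of length
  \<open>n\<close>, wherever they start.\<close>

lemma card_shifted_residue:
  fixes a c m n :: nat
  assumes "a < n"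
  shows "card {i. i < n * m \<and> (c + i) mod n = a} = m"
proof -
  \<comment> \<open>The shifted residue is computed in the integers because \<open>a - c\<close>
    would truncate for naturals.\<close>
  define r where "r = nat ((int a - int c) mod int n)"
  have n: "n > 0" using assms by simp
  have r: "int r = (int a - int c) mod int n" using n by (simp add: r_def)
  have "int r < int n" unfolding r using n by simp
  then have rn: "r < n" by simp
  have iff: "(c + i) mod n = a \<longleftrightarrow> i mod n = r" for i
  proof -
    have "(c + i) mod n = a \<longleftrightarrow> int (c + i) mod int n = int a mod int n"
      using assms by (metis mod_less of_nat_eq_iff zmod_int)
    also have "\<dots> \<longleftrightarrow> int i mod int n = (int a - int c) mod int n"
      by (simp add: mod_eq_dvd_iff algebra_simps)
    also have "\<dots> \<longleftrightarrow> i mod n = r"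
      by (metis r of_nat_eq_iff zmod_int)
    finally show ?thesis .
  qed
  have "{i. i < n * m \<and> i mod n = r} = (\<lambda>t. n * t + r) ` {..<m}"
  proof (intro equalityI subsetI)
    fix i assume "i \<in> {i. i < n * m \<and> i mod n = r}"
    then have "i div n < m" "i = n * (i div n) + r"
      by (auto simp: less_mult_imp_div_less mult.commute)
    then show "i \<in> (\<lambda>t. n * t + r) ` {..<m}" by blast
  next
    fix i assume "i \<in> (\<lambda>t. n * t + r) ` {..<m}"
    then obtain t where t: "t < m" "i = n * t + r" by blast
    have "n * t + r < n * Suc t" using rn by simp
    also have "\<dots> \<le> n * m" using t by (intro mult_left_mono) auto
    finally show "i \<in> {i. i < n * m \<and> i mod n = r}" using t rn by simp
  qed
  moreover have "inj_on (\<lambda>t. n * t + r) {..<m}" using n by (simp add: inj_on_def)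
  ultimately show ?thesis unfolding iff by (simp add: card_image)
qed

theorem theorem6:
  fixes n w :: nat
  assumes "n \<ge> 2" and "1 \<le> w" and "w \<le> n - 1"
    and "\<exists>G. cyclic_optimal_gray_code n w G"
  shows "\<forall>a\<in>{0..n - 1}. real (card {v \<in> strings n w. color n v = a}) = real (n choose w) / real n"
proof
  fix a assume "a \<in> {0..n - 1}"
  then have a: "a < n" using assms(1) by simp
  define N where "N = n choose w"
  obtain G where G: "cyclic_gray_code n w N G"
    using assms(4) by (auto simp: cyclic_optimal_gray_code_def N_def)
  then have len: "length G = N" and dist: "distinct G" and sub: "set G \<subseteq> strings n w"
    and step: "\<And>i. i + 1 < N \<Longrightarrow> \<exists>j<n. G ! (i + 1) = tau n j (G ! i)"
    and close: "\<exists>j<n. G ! 0 = tau n j (G ! (N - 1))" and N0: "N > 0"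
    by (auto simp: cyclic_gray_code_def gray_code_def)
  \<comment> \<open>With a single string the closing step would fix it, and \<open>color_tau\<close>
    would not apply. Pascal's rule writes \<open>N\<close> as a sum of two positive numbers.\<close>
  have N1: "N \<noteq> 1"
  proof -
    have "(n - 1) choose (w - 1) > 0" "(n - 1) choose w > 0" using assms(2,3) by simp_all
    moreover have "N = ((n - 1) choose (w - 1)) + ((n - 1) choose w)"
      unfolding N_def using assms(1,2) by (intro choose_reduce_nat) auto
    ultimately show ?thesis by linarith
  qed
  \<comment> \<open>An infinite set has \<open>card\<close> 0, whereas here the cardinality is
    \<open>N > 0\<close>.\<close>
  have "finite (strings n w)"
    using card_strings[of n w] N0 by (metis N_def card.infinite less_irrefl)
  moreover have "card (set G) = card (strings n w)"
    using dist len by (simp add: distinct_card card_strings N_def)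
  ultimately have setG: "set G = strings n w" using sub by (intro card_subset_eq)
  have mem: "G ! i \<in> strings n w" if "i < N" for i using that len setG nth_mem by blast
  \<comment> \<open>Stated for arbitrary distinct indices so that it covers both the inner steps and
    the closing one; distinctness of \<open>G\<close> excludes fixed strings.\<close>
  have succ: "color n (G ! i') = (color n (G ! i) + 1) mod n"
    if "\<exists>j<n. G ! i' = tau n j (G ! i)" "i < N" "i' < N" "i \<noteq> i'" for i i'
    using that color_tau mem assms(1) dist len by (metis nth_eq_iff_index_eq)
  define c where "c = color n (G ! 0)"
  have c: "c < n" using assms(1) by (simp add: c_def color_def)
  have col: "color n (G ! i) = (c + i) mod n" if "i < N" for i
    using that
  proof (induction i)
    case 0
    then show ?case using c by (simp add: c_def)
  next
    case (Suc i)
    then show ?case using succ[OF step[of i]] by (simp add: mod_Suc_eq)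
  qed
  \<comment> \<open>The closing step returns to \<open>c\<close> after \<open>N\<close> increments
    in total, hence \<open>n\<close> divides \<open>N\<close>.\<close>
  have "c = (color n (G ! (N - 1)) + 1) mod n"
    unfolding c_def using close N0 N1 by (intro succ) auto
  also have "\<dots> = (c + N) mod n"
    using col[of "N - 1"] N0 by (simp add: mod_Suc_eq)
  finally have "[c + N = c + 0] (mod n)" using c by (simp add: cong_def)
  then have "n dvd N" by (simp only: cong_add_lcancel_nat cong_0_iff)
  then obtain m where m: "N = n * m" by blast
  \<comment> \<open>Each string occurs at exactly one index, so counting strings of color
    \<open>a\<close> becomes counting indices.\<close>
  have "{v \<in> strings n w. color n v = a} = (!) G ` {i. i < N \<and> (c + i) mod n = a}"
    using col len by (auto simp: setG[symmetric] in_set_conv_nth)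
  moreover have "inj_on ((!) G) {i. i < N \<and> (c + i) mod n = a}"
    using dist len by (auto intro!: inj_on_nth)
  ultimately have "card {v \<in> strings n w. color n v = a} = m"
    using card_shifted_residue[OF a, of m c] by (simp add: card_image m)
  then show "real (card {v \<in> strings n w. color n v = a}) = real (n choose w) / real n"
    using m assms(1) by (simp add: N_def)
qed

end
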